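(* Let $d\in\mathbb{N}$, $m>0$, $T>0$, $\sigma_0>0$, $a_0,c_0\in\mathbb{R}$, $\boldsymbol{\mu}_0,\mathbf{u}_0\in\mathbb{R}^d$, and define, for $x\in\mathbb{R}^d$, $$\rho_0(x):=\frac{1}{(2\pi\sigma_0^2)^{d/2}}\exp\Big(-\frac{|x-\boldsymbol{\mu}_0|^2}{2\sigma_0^2}\Big),\qquad \theta_0(x):=\frac{m a_0}{2\sigma_0}|x-\boldsymbol{\mu}_0|^2+m\,\mathbf{u}_0\cdot(x-\boldsymbol{\mu}_0)+c_0 .$$ For $t\in[0,T]$ define $$\boldsymbol{\mu}(t):=\boldsymbol{\mu}_0+t\mathbf{u}_0,\qquad \sigma(t):=\Big((\sigma_0+a_0t)^2+\frac{t^2}{4m^2\sigma_0^2}\Big)^{1/2},\qquad \gamma(t):=c_0+\frac m2|\mathbf{u}_0|^2t-\frac{d}{4m}\int_0^t\frac{\mathrm{d}\tau}{\sigma(\tau)^2}.$$ Then the functions $\rho\colon\mathbb{R}^d\times[0,T]\to\mathbb{R}_{>0}$ and $\theta\colon\mathbb{R}^d\times[0,T]\to\mathbb{R}$ defined by $$\rho(x,t):=\frac{1}{(2\pi\sigma(t)^2)^{d/2}}\exp\Big(-\frac{|x-\boldsymbol{\mu}(t)|^2}{2\sigma(t)^2}\Big),\qquad \theta(x,t):=\frac{m\dot\sigma(t)}{2\sigma(t)}|x-\boldsymbol{\mu}(t)|^2+m\,\mathbf{u}_0\cdot(x-\boldsymbol{\mu}(t))+\gamma(t)$$ constitute a positive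 classical solution of the free Madelung problem (see context) with initial data $(\rho_0,\theta_0)$. Moreover, the associated hydrodynamic velocity field $\mathbf{v}:=\frac1m\nabla\theta$ is given, for every $(x,t)\in\mathbb{R}^d\times[0,T]$, by $$\mathbf{v}(x,t)=\mathbf{u}_0+\frac{\dot\sigma(t)}{\sigma(t)}(x-\boldsymbol{\mu}(t)),$$ and, consequently, the corresponding characteristic flow $X\colon[0,T]\times\mathbb{R}^d\to\mathbb{R}^d$ is given, for every $(t,x)\in[0,T]\times\mathbb{R}^d$, by $$X(t;x)=\boldsymbol{\mu}(t)+\frac{\sigma(t)}{\sigma_0}(x-\boldsymbol{\mu}_0),$$ and satisfies $$[X(t;\cdot)]_{\#}(\rho_0\,\mathrm{d}x)=\rho(\cdot,t)\,\mathrm{d}x\quad\text{in }\mathcal{P}(\mathbb{R}^d)\quad\text{for all }t\in[0,T].$$ In particular, if $X_0\sim\mathcal{N}(\boldsymbol{\mu}_0,\sigma_0^2I_d)$, then $X(t;X_0)\sim\mathcal{N}(\boldsymbol{\mu}(t),\sigma(t)^2I_d)$ for all $t\in[0,T]$.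
   Context: For positive sufficiently regular $\rho$, the Bohm quantum potential (units $\hbar=1$) is $Q_{\mathrm{B}}(\rho):=-\frac{1}{2m}\frac{\Delta\sqrt{\rho}}{\sqrt{\rho}}$. The free Madelung problem with initial data $(\rho_0,\theta_0)$ is $$\partial_t\rho+\tfrac1m\operatorname{div}(\rho\nabla\theta)=0\ \text{ in }\mathbb{R}^d\times(0,T),\qquad \partial_t\theta+\tfrac{1}{2m}|\nabla\theta|^2+Q_{\mathrm{B}}(\rho)=0\ \text{ in }\mathbb{R}^d\times(0,T),$$ $$\rho(\cdot,0)=\rho_0,\qquad\theta(\cdot,0)=\theta_0\ \text{ in }\mathbb{R}^d,$$ with $\nabla,\operatorname{div},\Delta$ acting in the spatial variable. A positive classical solution is a pair $(\rho,\theta)\in[C^1([0,T];C^0_{\mathrm{loc}}(\mathbb{R}^d))\cap C^0([0,T];C^2_{\mathrm{loc}}(\mathbb{R}^d))]^2$ satisfying these equations pointwise, with $\rho>0$ on $\mathbb{R}^d\times[0,T]$ and $\rho(\cdot,t)$ a probability density (nonnegative, integral one) for all $t\in[0,T]$. Here $C^k([0,T];C^l_{\mathrm{loc}}(\mathbb{R}^d))$ consists of functions $f$ such that for every compact set (e.g. closed ball) $K\subset\mathbb{R}^d$ the map $t\mapsto f(\cdot,t)|_K$ belongs to $C^k([0,T];C^l(K))$. The characteristic flow generated by $\mathbf{v}$ is the unique solution $X\colon[0,T]\times\mathbb{R}^d\to\mathbb{R}^d$ of $\partial_tX(t;x)=\mathbf{v}(X(t;x),t)$ for $(t,x)\in(0,T)\times\mathbb{R}^d$,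 $X(0;x)=x$ for $x\in\mathbb{R}^d$. $\mathcal{P}(\mathbb{R}^d)$ is the set of Borel probability measures on $\mathbb{R}^d$, $f\,\mathrm{d}x$ is the measure with Lebesgue density $f$, $F_{\#}\mu$ is the pushforward, and a dot denotes the time derivative. $\mathcal{N}(\boldsymbol{\mu},\sigma^2I_d)$ is the isotropic Gaussian distribution on $\mathbb{R}^d$ with mean $\boldsymbol{\mu}$ and covariance $\sigma^2I_d$. *)

theory Defs
  imports "HOL-Probability.Probability"
begin

section \<open>Spatial differential operators\<close>

definition partial :: "'a::euclidean_space \<Rightarrow> ('a \<Rightarrow> real) \<Rightarrow> 'a \<Rightarrow> real" where
  "partial b f x = frechet_derivative f (at x) b"

definition gradient :: "('a::euclidean_space \<Rightarrow> real) \<Rightarrow> 'a \<Rightarrow> 'a" where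
  "gradient f x = (\<Sum>b\<in>Basis. partial b f x *\<^sub>R b)"

definition divergence :: "('a::euclidean_space \<Rightarrow> 'a) \<Rightarrow> 'a \<Rightarrow> real" where
  "divergence V x = (\<Sum>b\<in>Basis. partial b (\<lambda>y. V y \<bullet> b) x)"

definition laplacian :: "('a::euclidean_space \<Rightarrow> real) \<Rightarrow> 'a \<Rightarrow> real" where
  "laplacian f x = (\<Sum>b\<in>Basis. partial b (partial b f) x)"

section \<open>The spaces \<open>C\<^sup>k([0,T]; C\<^sup>l\<^sub>l\<^sub>o\<^sub>c)\<close>\<close>

text \<open>Scalar functions on the whole space all of whose partial derivatives up to order \<open>l\<close>
  exist and are continuous.\<close>

primrec C_space :: "nat \<Rightarrow> ('a::euclidean_space \<Rightarrow> real) \<Rightarrow> bool" where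
  "C_space 0 f \<longleftrightarrow> continuous_on UNIV f"
| "C_space (Suc l) f \<longleftrightarrow>
     (\<forall>x. f differentiable (at x)) \<and> (\<forall>b\<in>Basis. C_space l (partial b f))"

text \<open>Convergence in \<open>C\<^sup>l(K)\<close> for every compact \<open>K\<close>: all partial derivatives up to order \<open>l\<close>
  converge in the supremum norm over \<open>K\<close>.\<close>

primrec C_loc_limit ::
  "nat \<Rightarrow> ('s \<Rightarrow> 'a::euclidean_space \<Rightarrow> real) \<Rightarrow> ('a \<Rightarrow> real) \<Rightarrow> 's filter \<Rightarrow> bool" where
  "C_loc_limit 0 u v F \<longleftrightarrow> (\<forall>K. compact K \<longrightarrow> uniform_limit K u v F)"
| "C_loc_limit (Suc l) u v F \<longleftrightarrow>
     (\<forall>K. compact K \<longrightarrow> uniform_limit K u v F) \<and>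
     (\<forall>b\<in>Basis. C_loc_limit l (\<lambda>s. partial b (u s)) (partial b v) F)"

text \<open>\<open>C_time k l T f\<close>: the function \<open>t \<mapsto> f(\<cdot>,t)\<close> is in \<open>C\<^sup>k([0,T]; C\<^sup>l(K))\<close> for every compact \<open>K\<close>.
  The time derivative \<open>g\<close> is the limit of the difference quotients in \<open>C\<^sup>l(K)\<close>, one-sided at
  the end points. As the derivatives for different \<open>K\<close> agree on common points, a single
  \<open>g\<close> serves all \<open>K\<close>.\<close>

primrec C_time ::
  "nat \<Rightarrow> nat \<Rightarrow> real \<Rightarrow> ('a::euclidean_space \<Rightarrow> real \<Rightarrow> real) \<Rightarrow> bool" where
  "C_time 0 l T f \<longleftrightarrow>
     (\<forall>t\<in>{0..T}. C_space l (\<lambda>x. f x t) \<and>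
        C_loc_limit l (\<lambda>s x. f x s) (\<lambda>x. f x t) (at t within {0..T}))"
| "C_time (Suc k) l T f \<longleftrightarrow>
     (\<forall>t\<in>{0..T}. C_space l (\<lambda>x. f x t)) \<and>
     (\<exists>g. C_time k l T g \<and>
        (\<forall>t\<in>{0..T}. C_loc_limit l (\<lambda>s x. (f x s - f x t) / (s - t)) (\<lambda>x. g x t)
           (at t within {0..T})))"

section \<open>The free Madelung problem\<close>

definition bohm_potential :: "real \<Rightarrow> ('a::euclidean_space \<Rightarrow> real) \<Rightarrow> 'a \<Rightarrow> real" where
  "bohm_potential m \<rho> x = - (1 / (2 * m)) * (laplacian (\<lambda>y. sqrt (\<rho> y)) x / sqrt (\<rho> x))"

definition free_madelung ::
  "real \<Rightarrow> real \<Rightarrow> ('a::euclidean_space \<Rightarrow> real) \<Rightarrow> ('a \<Rightarrow> real) \<Rightarrow>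
   ('a \<Rightarrow> real \<Rightarrow> real) \<Rightarrow> ('a \<Rightarrow> real \<Rightarrow> real) \<Rightarrow> bool" where
  "free_madelung m T \<rho>0 \<theta>0 \<rho> \<theta> \<longleftrightarrow>
     (\<forall>x. \<forall>t\<in>{0<..<T}.
        deriv (\<lambda>s. \<rho> x s) t
          + 1 / m * divergence (\<lambda>y. \<rho> y t *\<^sub>R gradient (\<lambda>z. \<theta> z t) y) x = 0) \<and>
     (\<forall>x. \<forall>t\<in>{0<..<T}.
        deriv (\<lambda>s. \<theta> x s) t
          + 1 / (2 * m) * (norm (gradient (\<lambda>y. \<theta> y t) x))\<^sup>2
          + bohm_potential m (\<lambda>y. \<rho> y t) x = 0) \<and>
     (\<forall>x. \<rho> x 0 = \<rho>0 x \<and> \<theta> x 0 = \<theta>0 x)"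

definition probability_density :: "('a::euclidean_space \<Rightarrow> real) \<Rightarrow> bool" where
  "probability_density f \<longleftrightarrow> (\<forall>x. 0 \<le> f x) \<and> has_bochner_integral lborel f 1"

definition positive_classical_solution ::
  "real \<Rightarrow> real \<Rightarrow> ('a::euclidean_space \<Rightarrow> real) \<Rightarrow> ('a \<Rightarrow> real) \<Rightarrow>
   ('a \<Rightarrow> real \<Rightarrow> real) \<Rightarrow> ('a \<Rightarrow> real \<Rightarrow> real) \<Rightarrow> bool" where
  "positive_classical_solution m T \<rho>0 \<theta>0 \<rho> \<theta> \<longleftrightarrow>
     C_time 1 0 T \<rho> \<and> C_time 0 2 T \<rho> \<and> C_time 1 0 T \<theta> \<and> C_time 0 2 T \<theta> \<and>
     free_madelung m T \<rho>0 \<theta>0 \<rho> \<theta> \<and>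
     (\<forall>x. \<forall>t\<in>{0..T}. 0 < \<rho> x t) \<and>
     (\<forall>t\<in>{0..T}. probability_density (\<lambda>x. \<rho> x t))"

section \<open>Characteristic flow\<close>

text \<open>Continuity on the closed interval ties the differential equation on \<open>(0,T)\<close> to the initial
  value at \<open>0\<close> (and to the value at \<open>T\<close>); without it uniqueness fails trivially.\<close>

definition solves_characteristics ::
  "real \<Rightarrow> ('a::euclidean_space \<Rightarrow> real \<Rightarrow> 'a) \<Rightarrow> (real \<Rightarrow> 'a \<Rightarrow> 'a) \<Rightarrow> bool" where
  "solves_characteristics T v X \<longleftrightarrow>
     (\<forall>x. continuous_on {0..T} (\<lambda>t. X t x)) \<and>
     (\<forall>x. \<forall>t\<in>{0<..<T}. ((\<lambda>s. X s x) has_vector_derivative v (X t x) t) (at t)) \<and>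
     (\<forall>x. X 0 x = x)"

definition characteristic_flow ::
  "real \<Rightarrow> ('a::euclidean_space \<Rightarrow> real \<Rightarrow> 'a) \<Rightarrow> (real \<Rightarrow> 'a \<Rightarrow> 'a) \<Rightarrow> bool" where
  "characteristic_flow T v X \<longleftrightarrow>
     solves_characteristics T v X \<and>
     (\<forall>Y. solves_characteristics T v Y \<longrightarrow> (\<forall>t\<in>{0..T}. \<forall>x. Y t x = X t x))"

section \<open>Isotropic Gaussian distribution\<close>

text \<open>Lebesgue density of \<open>\<N>(\<mu>, \<sigma>\<^sup>2 I)\<close>, for \<open>\<sigma> > 0\<close>.\<close>

definition isotropic_normal_density :: "'a::euclidean_space \<Rightarrow> real \<Rightarrow> 'a \<Rightarrow> real" where
  "isotropic_normal_density \<mu> \<sigma> x =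
     1 / (2 * pi * \<sigma>\<^sup>2) powr (real DIM('a) / 2) * exp (- (norm (x - \<mu>))\<^sup>2 / (2 * \<sigma>\<^sup>2))"

lemma isotropic_normal_density_eq_prod:
  fixes \<mu> :: "'a::euclidean_space"
  assumes "0 < \<sigma>"
  shows "isotropic_normal_density \<mu> \<sigma> x = (\<Prod>b\<in>Basis. normal_density (\<mu> \<bullet> b) \<sigma> (x \<bullet> b))"
proof -
  have pos: "0 < 2 * pi * \<sigma>\<^sup>2"
    using assms by simp
  have "(2 * pi * \<sigma>\<^sup>2) powr (real DIM('a) / 2)
      = ((2 * pi * \<sigma>\<^sup>2) powr (1 / 2)) powr real DIM('a)"
    by (simp only: powr_powr) simp
  also have "\<dots> = sqrt (2 * pi * \<sigma>\<^sup>2) ^ DIM('a)"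
    using pos by (simp only: powr_half_sqrt powr_realpow real_sqrt_gt_0_iff less_imp_le)
  finally have "(\<Prod>b\<in>(Basis::'a set). 1 / sqrt (2 * pi * \<sigma>\<^sup>2))
      = 1 / (2 * pi * \<sigma>\<^sup>2) powr (real DIM('a) / 2)"
    by (simp only: prod_constant power_one_over)
  moreover have "(norm (x - \<mu>))\<^sup>2 = (\<Sum>b\<in>Basis. (x \<bullet> b - \<mu> \<bullet> b)\<^sup>2)"
    unfolding dot_square_norm[symmetric]
    by (subst euclidean_inner) (simp add: inner_diff_left power2_eq_square)
  then have "(\<Prod>b\<in>Basis. exp (- (x \<bullet> b - \<mu> \<bullet> b)\<^sup>2 / (2 * \<sigma>\<^sup>2)))
      = exp (- (norm (x - \<mu>))\<^sup>2 / (2 * \<sigma>\<^sup>2))"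
    by (simp add: exp_sum[symmetric] sum_divide_distrib[symmetric] sum_negf)
  ultimately show ?thesis
    unfolding isotropic_normal_density_def normal_density_def prod.distrib by simp
qed

end

theory Submission
  imports Defs
begin

text \<open>Write \<open>\<alpha> = \<sigma>'/\<sigma>\<close>, so that the phase is a quadratic polynomial in \<open>x - \<mu>(t)\<close> with leading
  coefficient \<open>m \<alpha> / 2\<close>, and the velocity is affine with slope \<open>\<alpha>\<close>. For a Gaussian of width \<open>\<sigma>\<close>,
  the continuity equation holds for any such \<open>\<alpha>\<close>, while the Bohm potential is itself quadratic
  in \<open>x - \<mu>(t)\<close>. Comparing coefficients, the phase equation amounts to the equation for \<open>\<gamma>\<close> and the
  Riccati equation \<open>\<alpha>' + \<alpha>\<^sup>2 = 1 / (4 m\<^sup>2 \<sigma>\<^sup>4)\<close>, which is the Ermakov equation for \<open>\<sigma>\<close>.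
  The characteristics are determined by the fact that \<open>(Y - \<mu>) / \<sigma>\<close> is constant along each of them;
  they are affine maps, and these carry isotropic Gaussians to isotropic Gaussians.\<close>

subsection \<open>Criteria for the local function spaces\<close>

lemma partial_eq:
  assumes "(f has_derivative f') (at x)"
  shows "partial b f x = f' b"
  unfolding partial_def using frechet_derivative_at[OF assms] by simp

lemma gradient_eq:
  assumes "(f has_derivative (\<lambda>h. g \<bullet> h)) (at x)"
  shows "gradient f x = g"
  by (simp add: gradient_def partial_eq[OF assms] euclidean_representation)

text \<open>Eventual equality of the functions passes to all their partial derivatives, so the
  recursion on the order goes through. This allows partial derivatives to be replaced by formulas
  that are known only for times in \<open>{0..T}\<close>.\<close>

lemma C_loc_limit_cong:
  assumes "\<forall>\<^sub>F s in F. u s = u' s"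
  shows "C_loc_limit l u v F \<longleftrightarrow> C_loc_limit l u' v F"
  using assms
proof (induction l arbitrary: u u' v)
  case 0
  have "uniform_limit K u v F \<longleftrightarrow> uniform_limit K u' v F" for K
    using 0 by (intro uniform_limit_cong) (auto elim: eventually_mono)
  then show ?case by simp
next
  case (Suc l)
  have "uniform_limit K u v F \<longleftrightarrow> uniform_limit K u' v F" for K
    using Suc.prems by (intro uniform_limit_cong) (auto elim: eventually_mono)
  moreover have "C_loc_limit l (\<lambda>s. partial b (u s)) (partial b v) F
      \<longleftrightarrow> C_loc_limit l (\<lambda>s. partial b (u' s)) (partial b v) F" for b
    using Suc.prems by (intro Suc.IH) (auto elim: eventually_mono)
  ultimately show ?case by simp
qed

text \<open>By the tube lemma, compactness of \<open>K\<close> yields one neighbourhood of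
  \<open>t\<close> that works for all points of \<open>K\<close> at once. Hence every convergence
  demanded on compact sets reduces to joint continuity in space and time.\<close>

lemma uniform_limit_jointly_continuous:
  fixes f :: "'a::metric_space \<Rightarrow> 's::metric_space \<Rightarrow> 'b::metric_space"
  assumes cont: "continuous_on (K \<times> S) (\<lambda>(x, t). f x t)" and "compact K" "t \<in> S"
  shows "uniform_limit K (\<lambda>s x. f x s) (\<lambda>x. f x t) (at t within S)"
proof (rule uniform_limitI)
  fix e :: real assume "e > 0"
  have "continuous_on (S \<times> K) (\<lambda>(s, x). f x s)"
    using continuous_on_swap_args[OF cont] .
  from continuous_on_prod_compactE[OF this \<open>compact K\<close> \<open>t \<in> S\<close>, of "e / 2"] \<open>e > 0\<close>
  obtain X0 where X0: "t \<in> X0" "open X0"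
    "\<forall>s\<in>X0 \<inter> S. \<forall>x\<in>K. dist (f x s) (f x t) \<le> e / 2"
    by auto
  then have "\<forall>\<^sub>F s in at t within S. s \<in> X0 \<inter> S"
    unfolding eventually_at_topological by auto
  then show "\<forall>\<^sub>F s in at t within S. \<forall>x\<in>K. dist (f x s) (f x t) < e"
  proof eventually_elim
    case (elim s)
    have "dist (f x s) (f x t) < e" if "x \<in> K" for x
    proof -
      have "dist (f x s) (f x t) \<le> e / 2"
        using X0(3) elim that by blast
      then show ?thesis
        using \<open>e > 0\<close> by simp
    qed
    then show ?case by blast
  qed
qed

lemma C_time_0_0I:
  assumes "continuous_on (UNIV \<times> {0..T}) (\<lambda>(x, t). f x t)"
  shows "C_time 0 0 T f"
proof -
  have "continuous_on UNIV (\<lambda>x. f x t)" if "t \<in> {0..T}" for t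
    using that continuous_on_compose2[OF assms, of UNIV "\<lambda>x. (x, t)"]
    by (simp add: continuous_on_Pair image_subset_iff)
  moreover have "uniform_limit K (\<lambda>s x. f x s) (\<lambda>x. f x t) (at t within {0..T})"
    if "compact K" "t \<in> {0..T}" for K t
    using that by (intro uniform_limit_jointly_continuous continuous_on_subset[OF assms]) auto
  ultimately show ?thesis
    by simp
qed

text \<open>This peels off one order of spatial regularity: two applications reduce the
  \<open>C^2\<close> condition on an explicit function to joint continuity of its derivatives up to
  order two.\<close>

lemma C_time_0_SucI:
  assumes cont: "continuous_on (UNIV \<times> {0..T}) (\<lambda>(x, t). f x t)"
    and deriv: "\<And>x t. t \<in> {0..T} \<Longrightarrow> ((\<lambda>y. f y t) has_derivative f' x t) (at x)"
    and rec: "\<And>b. b \<in> Basis \<Longrightarrow> C_time 0 l T (\<lambda>x t. f' x t b)"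
  shows "C_time 0 (Suc l) T f"
proof -
  have partial: "partial b (\<lambda>x. f x t) = (\<lambda>x. f' x t b)" if "t \<in> {0..T}" for b t
    using deriv[OF that] by (auto intro: partial_eq)
  have "C_space (Suc l) (\<lambda>x. f x t)" if "t \<in> {0..T}" for t
    using deriv[OF that] rec that by (auto simp: partial differentiable_def)
  moreover have "C_loc_limit (Suc l) (\<lambda>s x. f x s) (\<lambda>x. f x t) (at t within {0..T})"
    if t: "t \<in> {0..T}" for t
  proof -
    \<comment> \<open>The derivative formula is available only for \<open>s\<close> in
      \<open>{0..T}\<close>, and the filter sees no other times.\<close>
    have "\<forall>\<^sub>F s in at t within {0..T}. partial b (\<lambda>x. f x s) = (\<lambda>x. f' x s b)" for b
      using partial by (auto simp: eventually_at_filter)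
    from C_loc_limit_cong[OF this] rec t C_time_0_0I[OF cont] show ?thesis
      by (simp add: partial)
  qed
  ultimately show ?thesis
    by simp
qed

text \<open>By the mean value theorem the difference quotient at \<open>x\<close> equals
  \<open>g x z\<close> for some \<open>z\<close> between \<open>s\<close> and \<open>t\<close>.
  Although \<open>z\<close> depends on \<open>x\<close>, it is as close to \<open>t\<close> as
  \<open>s\<close> is, so the locally uniform convergence of \<open>g\<close> in time carries over
  to the quotients.\<close>

lemma C_time_1_0I:
  assumes f: "\<And>t. t \<in> {0..T} \<Longrightarrow> continuous_on UNIV (\<lambda>x. f x t)"
    and g: "continuous_on (UNIV \<times> {0..T}) (\<lambda>(x, t). g x t)"
    and deriv: "\<And>x t. t \<in> {0..T} \<Longrightarrow> ((\<lambda>s. f x s) has_real_derivative g x t) (at t within {0..T})"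
  shows "C_time 1 0 T f"
proof -
  have "uniform_limit K (\<lambda>s x. (f x s - f x t) / (s - t)) (\<lambda>x. g x t) (at t within {0..T})"
    if K: "compact K" and t: "t \<in> {0..T}" for K t
  proof (rule uniform_limitI)
    fix e :: real assume "e > 0"
    have "uniform_limit K (\<lambda>s x. g x s) (\<lambda>x. g x t) (at t within {0..T})"
      using C_time_0_0I[OF g] K t by simp
    from uniform_limitD[OF this \<open>e > 0\<close>] obtain d where d: "d > 0"
      "\<And>s x. s \<in> {0..T} \<Longrightarrow> s \<noteq> t \<Longrightarrow> dist s t < d \<Longrightarrow> x \<in> K \<Longrightarrow> dist (g x s) (g x t) < e"
      unfolding eventually_at by auto
    have "dist ((f x s - f x t) / (s - t)) (g x t) < e"
      if s: "s \<in> {0..T}" "s \<noteq> t" "dist s t < d" and x: "x \<in> K" for s x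
    proof -
      \<comment> \<open>Restricting the derivative within \<open>{0..T}\<close> to
        \<open>{a..b}\<close> also covers intervals that touch the end points, where only one-sided
        derivatives exist.\<close>
      have mvt: "\<exists>z\<in>{a<..<b}. f x b - f x a = g x z * (b - a)" if "0 \<le> a" "a < b" "b \<le> T" for a b
      proof (rule mvt_simple[OF \<open>a < b\<close>])
        fix z assume "a \<le> z" "z \<le> b"
        then show "((\<lambda>s. f x s) has_derivative (*) (g x z)) (at z within {a..b})"
          using that has_field_derivative_subset[OF deriv[of z x], of "{a..b}"]
          by (auto simp: has_field_derivative_def)
      qed
      \<comment> \<open>The condition \<open>z \<noteq> t\<close> is kept because the estimate on
        \<open>g\<close> comes from a punctured neighbourhood of \<open>t\<close>.\<close>
      have "\<exists>z\<in>{min s t..max s t}. z \<noteq> t \<and> (f x s - f x t) / (s - t) = g x z"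
      proof (cases "s < t")
        case True
        with mvt[of s t] s t show ?thesis
          by (force simp: field_simps)
      next
        case False
        with mvt[of t s] s t show ?thesis
          by (force simp: field_simps)
      qed
      then obtain z where z: "z \<in> {min s t..max s t}" "z \<noteq> t"
        "(f x s - f x t) / (s - t) = g x z"
        by blast
      moreover have "z \<in> {0..T}" "dist z t < d"
        using z s t by (auto simp: dist_real_def)
      ultimately show ?thesis
        using d(2) x by auto
    qed
    then show "\<forall>\<^sub>F s in at t within {0..T}. \<forall>x\<in>K. dist ((f x s - f x t) / (s - t)) (g x t) < e"
      unfolding eventually_at using \<open>d > 0\<close> by blast
  qed
  then show ?thesis
    using f C_time_0_0I[OF g] by auto
qed

subsection \<open>Differential calculus of Gaussians\<close>

lemma has_derivative_norm_diff_squared: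
  fixes c :: "'a::real_inner"
  shows "((\<lambda>y. (norm (y - c))\<^sup>2) has_derivative (\<lambda>h. 2 * ((x - c) \<bullet> h))) (at x within S)"
  unfolding power2_norm_eq_inner
  by (auto intro!: derivative_eq_intros simp: inner_commute)

lemma isotropic_normal_density_pos:
  assumes "0 < \<sigma>"
  shows "0 < isotropic_normal_density \<mu> \<sigma> x"
  using assms by (simp add: isotropic_normal_density_def)

lemma continuous_on_isotropic_normal_density [continuous_intros]:
  assumes "continuous_on A m" "continuous_on A s" "continuous_on A y" "\<And>z. z \<in> A \<Longrightarrow> 0 < s z"
  shows "continuous_on A (\<lambda>z. isotropic_normal_density (m z) (s z) (y z))"
  unfolding isotropic_normal_density_def
  by (intro continuous_intros assms) (auto dest: assms(4))

lemma isotropic_normal_density_has_derivative: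
  assumes "0 < \<sigma>"
  shows "(isotropic_normal_density \<mu> \<sigma> has_derivative
     (\<lambda>h. - isotropic_normal_density \<mu> \<sigma> x / \<sigma>\<^sup>2 * ((x - \<mu>) \<bullet> h))) (at x)"
proof -
  \<comment> \<open>With the normalisation frozen as \<open>C\<close>, the density is a function of
    the single real variable \<open>r\<close>, composed with the squared distance.\<close>
  define C where "C = 1 / (2 * pi * \<sigma>\<^sup>2) powr (real DIM('a) / 2)"
  have "((\<lambda>r. C * exp (- r / (2 * \<sigma>\<^sup>2))) has_real_derivative
      C * (exp (- r / (2 * \<sigma>\<^sup>2)) * (- 1 / (2 * \<sigma>\<^sup>2)))) (at r)" for r
    by (intro DERIV_cmult DERIV_chain2[OF DERIV_exp] DERIV_cdivide DERIV_minus DERIV_ident)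
  from has_derivative_compose[OF has_derivative_norm_diff_squared[of \<mu> x]
      this[unfolded has_field_derivative_def]]
  show ?thesis
    unfolding isotropic_normal_density_def[abs_def] C_def[symmetric] by (simp add: mult_ac)
qed

text \<open>The square root is, up to a constant, a Gaussian of variance
  \<open>2 * \<sigma>\<^sup>2\<close>, whence the denominator. In the chain rule this appears
  through f / sqrt f = sqrt f, which uses positivity.\<close>

lemma sqrt_isotropic_normal_density_has_derivative:
  assumes "0 < \<sigma>"
  shows "((\<lambda>x. sqrt (isotropic_normal_density \<mu> \<sigma> x)) has_derivative
     (\<lambda>h. - sqrt (isotropic_normal_density \<mu> \<sigma> x) / (2 * \<sigma>\<^sup>2) * ((x - \<mu>) \<bullet> h))) (at x)"
proof -
  have pos: "0 < isotropic_normal_density \<mu> \<sigma> x"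
    using assms by (rule isotropic_normal_density_pos)
  have "inverse (sqrt (isotropic_normal_density \<mu> \<sigma> x)) / 2 *
        (- isotropic_normal_density \<mu> \<sigma> x / \<sigma>\<^sup>2 * y)
      = - (isotropic_normal_density \<mu> \<sigma> x / sqrt (isotropic_normal_density \<mu> \<sigma> x)) / (2 * \<sigma>\<^sup>2) * y" for y
    by (simp only: divide_inverse inverse_mult_distrib mult_minus_left mult_minus_right mult_ac)
  then have eq: "inverse (sqrt (isotropic_normal_density \<mu> \<sigma> x)) / 2 *
        (- isotropic_normal_density \<mu> \<sigma> x / \<sigma>\<^sup>2 * y)
      = - sqrt (isotropic_normal_density \<mu> \<sigma> x) / (2 * \<sigma>\<^sup>2) * y" for y
    using pos by (simp only: real_div_sqrt less_imp_le)
  show ?thesis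
    using has_derivative_compose[OF isotropic_normal_density_has_derivative[OF assms, of \<mu> x]
        DERIV_real_sqrt[OF pos, unfolded has_field_derivative_def]]
    unfolding eq .
qed

text \<open>Logarithmic differentiation: the density is the exponential of its logarithm, so the
  derivative is the density times that of the exponent. The normalisation contributes the term with
  the dimension, the moving width and centre contribute the rest.\<close>

lemma isotropic_normal_density_has_time_derivative:
  fixes \<mu> :: "real \<Rightarrow> 'a::euclidean_space"
  assumes \<mu>: "(\<mu> has_vector_derivative \<mu>') (at t within S)"
    and \<sigma>: "(\<sigma> has_real_derivative \<sigma>') (at t within S)"
    and pos: "\<And>s. 0 < \<sigma> s"
  shows "((\<lambda>s. isotropic_normal_density (\<mu> s) (\<sigma> s) x) has_real_derivative
     isotropic_normal_density (\<mu> t) (\<sigma> t) x *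
       (\<sigma>' / \<sigma> t * ((norm (x - \<mu> t))\<^sup>2 / (\<sigma> t)\<^sup>2 - real DIM('a)) + ((x - \<mu> t) \<bullet> \<mu>') / (\<sigma> t)\<^sup>2))
     (at t within S)"
proof -
  \<comment> \<open>The squared distance is read as a function of the moving point
    \<open>\<mu> s\<close> with fixed centre \<open>x\<close>; this order of the difference makes
    the spatial derivative formula compose with the motion of \<open>\<mu>\<close>.\<close>
  define N where "N = (\<lambda>s. (norm (\<mu> s - x))\<^sup>2)"
  have eq: "isotropic_normal_density (\<mu> s) (\<sigma> s) x =
      exp (- (real DIM('a) / 2 * ln (2 * pi * (\<sigma> s)\<^sup>2)) + - N s / (2 * (\<sigma> s)\<^sup>2))" for s
    using pos[of s] unfolding exp_add
    by (simp add: isotropic_normal_density_def powr_def exp_minus N_def norm_minus_commute inverse_eq_divide)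
  have N: "(N has_real_derivative 2 * ((\<mu> t - x) \<bullet> \<mu>')) (at t within S)"
    using has_derivative_compose[OF \<mu>[unfolded has_vector_derivative_def] has_derivative_norm_diff_squared[of x]]
    unfolding N_def has_field_derivative_def
    by (rule has_derivative_eq_rhs) (simp add: fun_eq_iff)
  have ln: "((\<lambda>s. ln (2 * pi * (\<sigma> s)\<^sup>2)) has_real_derivative 2 * \<sigma>' / \<sigma> t) (at t within S)"
    using pos[of t] by (auto intro!: derivative_eq_intros \<sigma> simp: field_simps power2_eq_square)
  have quot: "((\<lambda>s. - N s / (2 * (\<sigma> s)\<^sup>2)) has_real_derivative
      - (2 * ((\<mu> t - x) \<bullet> \<mu>')) / (2 * (\<sigma> t)\<^sup>2) + N t * \<sigma>' / (\<sigma> t) ^ 3) (at t within S)"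
    using pos[of t] by (auto intro!: derivative_eq_intros \<sigma> N simp: field_simps eval_nat_numeral)
  have "((\<lambda>s. exp (- (real DIM('a) / 2 * ln (2 * pi * (\<sigma> s)\<^sup>2)) + - N s / (2 * (\<sigma> s)\<^sup>2)))
      has_real_derivative
      exp (- (real DIM('a) / 2 * ln (2 * pi * (\<sigma> t)\<^sup>2)) + - N t / (2 * (\<sigma> t)\<^sup>2)) *
      (- (real DIM('a) / 2 * (2 * \<sigma>' / \<sigma> t)) +
       (- (2 * ((\<mu> t - x) \<bullet> \<mu>')) / (2 * (\<sigma> t)\<^sup>2) + N t * \<sigma>' / (\<sigma> t) ^ 3))) (at t within S)"
    by (intro DERIV_chain2[OF DERIV_exp] DERIV_add DERIV_minus DERIV_cmult ln quot)
  moreover have "- (real DIM('a) / 2 * (2 * \<sigma>' / \<sigma> t)) +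
       (- (2 * ((\<mu> t - x) \<bullet> \<mu>')) / (2 * (\<sigma> t)\<^sup>2) + N t * \<sigma>' / (\<sigma> t) ^ 3) =
      \<sigma>' / \<sigma> t * ((norm (x - \<mu> t))\<^sup>2 / (\<sigma> t)\<^sup>2 - real DIM('a)) + ((x - \<mu> t) \<bullet> \<mu>') / (\<sigma> t)\<^sup>2"
  proof -
    have "(\<mu> t - x) \<bullet> \<mu>' = - ((x - \<mu> t) \<bullet> \<mu>')"
      by (simp add: inner_diff_left)
    moreover have "N t = (norm (x - \<mu> t))\<^sup>2"
      by (simp add: N_def norm_minus_commute)
    ultimately show ?thesis
      by (simp add: right_diff_distrib power2_eq_square power3_eq_cube mult_ac)
  qed
  ultimately show ?thesis
    unfolding eq by (simp only:)
qed

lemma divergence_eq: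
  assumes "(V has_derivative V') (at x)"
  shows "divergence V x = (\<Sum>b\<in>Basis. V' b \<bullet> b)"
  unfolding divergence_def
  by (intro sum.cong refl partial_eq has_derivative_inner_left assms)

lemma sum_Basis_inner_square:
  fixes x :: "'a::euclidean_space"
  shows "(\<Sum>b\<in>Basis. (x \<bullet> b)\<^sup>2) = (norm x)\<^sup>2"
  unfolding power2_norm_eq_inner by (subst euclidean_inner) (simp add: power2_eq_square)

text \<open>The product rule gives f div V + grad f . V, where div V is \<open>\<alpha>\<close>
  times the dimension and grad f is -f (x - \<open>\<mu>\<close>) /
  \<open>\<sigma>\<^sup>2\<close>.\<close>

lemma divergence_isotropic_normal_flux:
  fixes \<mu> w :: "'a::euclidean_space"
  assumes "0 < \<sigma>"
  shows "divergence (\<lambda>y. isotropic_normal_density \<mu> \<sigma> y *\<^sub>R (w + \<alpha> *\<^sub>R (y - \<mu>))) x =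
    isotropic_normal_density \<mu> \<sigma> x *
      (real DIM('a) * \<alpha> - ((x - \<mu>) \<bullet> w) / \<sigma>\<^sup>2 - \<alpha> * (norm (x - \<mu>))\<^sup>2 / \<sigma>\<^sup>2)"
proof -
  let ?f = "isotropic_normal_density \<mu> \<sigma>"
  define z where "z = x - \<mu>"
  have "((\<lambda>y. ?f y *\<^sub>R (w + \<alpha> *\<^sub>R (y - \<mu>))) has_derivative
      (\<lambda>h. ?f x *\<^sub>R \<alpha> *\<^sub>R h + (- ?f x / \<sigma>\<^sup>2 * ((x - \<mu>) \<bullet> h)) *\<^sub>R (w + \<alpha> *\<^sub>R (x - \<mu>)))) (at x)"
    by (auto intro!: derivative_eq_intros isotropic_normal_density_has_derivative[OF assms])
  from divergence_eq[OF this]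
  have "divergence (\<lambda>y. ?f y *\<^sub>R (w + \<alpha> *\<^sub>R (y - \<mu>))) x =
    (\<Sum>b\<in>Basis. (?f x *\<^sub>R \<alpha> *\<^sub>R b + (- ?f x / \<sigma>\<^sup>2 * (z \<bullet> b)) *\<^sub>R (w + \<alpha> *\<^sub>R z)) \<bullet> b)"
    by (simp add: z_def)
  also have "\<dots> = (\<Sum>b\<in>Basis. ?f x * \<alpha> - ?f x / \<sigma>\<^sup>2 * ((z \<bullet> b) * (w \<bullet> b)) - ?f x / \<sigma>\<^sup>2 * \<alpha> * (z \<bullet> b)\<^sup>2)"
    by (intro sum.cong refl)
       (simp add: inner_add_left inner_diff_left inner_Basis power2_eq_square ring_distribs mult_ac
          add_divide_distrib)
  also have "\<dots> = (\<Sum>b\<in>(Basis::'a set). ?f x * \<alpha>) - ?f x / \<sigma>\<^sup>2 * (\<Sum>b\<in>Basis. (z \<bullet> b) * (w \<bullet> b))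
        - ?f x / \<sigma>\<^sup>2 * \<alpha> * (\<Sum>b\<in>Basis. (z \<bullet> b)\<^sup>2)"
    by (simp add: sum_subtractf sum_distrib_left)
  also have "\<dots> = ?f x * (real DIM('a) * \<alpha> - (z \<bullet> w) / \<sigma>\<^sup>2 - \<alpha> * (norm z)\<^sup>2 / \<sigma>\<^sup>2)"
    unfolding sum_Basis_inner_square euclidean_inner[of z w, symmetric]
    by (simp add: right_diff_distrib mult_ac)
  finally show ?thesis
    unfolding z_def .
qed

text \<open>The root \<open>r\<close> satisfies grad r = -r (x - \<open>\<mu>\<close>) / (2
  \<open>\<sigma>\<^sup>2\<close>). Differentiating once more reproduces the factor
  \<open>r\<close>, which cancels in the quotient and leaves a quadratic polynomial.\<close>

lemma bohm_potential_isotropic_normal: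
  fixes \<mu> :: "'a::euclidean_space"
  assumes "0 < \<sigma>"
  shows "bohm_potential m (isotropic_normal_density \<mu> \<sigma>) x =
    1 / (2 * m) * (real DIM('a) / (2 * \<sigma>\<^sup>2) - (norm (x - \<mu>))\<^sup>2 / (4 * \<sigma> ^ 4))"
proof -
  define r where "r = (\<lambda>x. sqrt (isotropic_normal_density \<mu> \<sigma> x))"
  have r: "0 < r x"
    using isotropic_normal_density_pos[OF assms] by (simp add: r_def)
  have deriv: "(r has_derivative (\<lambda>h. - r x / (2 * \<sigma>\<^sup>2) * ((x - \<mu>) \<bullet> h))) (at x)" for x
    unfolding r_def by (rule sqrt_isotropic_normal_density_has_derivative[OF assms])
  have "partial b (partial b r) x = r x / (4 * \<sigma> ^ 4) * ((x - \<mu>) \<bullet> b)\<^sup>2 - r x / (2 * \<sigma>\<^sup>2)"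
    if "b \<in> Basis" for b
  proof -
    have "((\<lambda>x. r x * ((x - \<mu>) \<bullet> b)) has_derivative
       (\<lambda>h. r x * (h \<bullet> b) + - r x / (2 * \<sigma>\<^sup>2) * ((x - \<mu>) \<bullet> h) * ((x - \<mu>) \<bullet> b))) (at x)"
      by (rule has_derivative_mult[OF deriv]) (auto intro!: derivative_eq_intros)
    from has_derivative_mult_right[OF this, of "- 1 / (2 * \<sigma>\<^sup>2)"]
    have "((\<lambda>x. - r x / (2 * \<sigma>\<^sup>2) * ((x - \<mu>) \<bullet> b)) has_derivative
       (\<lambda>h. - 1 / (2 * \<sigma>\<^sup>2) * (r x * (h \<bullet> b) + - r x / (2 * \<sigma>\<^sup>2) * ((x - \<mu>) \<bullet> h) * ((x - \<mu>) \<bullet> b)))) (at x)"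
      by simp
    moreover have "partial b r = (\<lambda>x. - r x / (2 * \<sigma>\<^sup>2) * ((x - \<mu>) \<bullet> b))"
      by (intro ext partial_eq deriv)
    ultimately show ?thesis
      using that
      by (simp add: partial_eq inner_Basis power2_eq_square power4_eq_xxxx ring_distribs mult_ac)
  qed
  then have "laplacian r x = (\<Sum>b\<in>(Basis::'a set). r x / (4 * \<sigma> ^ 4) * ((x - \<mu>) \<bullet> b)\<^sup>2 - r x / (2 * \<sigma>\<^sup>2))"
    by (simp add: laplacian_def)
  also have "\<dots> = r x / (4 * \<sigma> ^ 4) * (norm (x - \<mu>))\<^sup>2 - real DIM('a) * (r x / (2 * \<sigma>\<^sup>2))"
    unfolding sum_subtractf sum_distrib_left[symmetric] sum_Basis_inner_square by simp
  finally have "laplacian r x / r x = (norm (x - \<mu>))\<^sup>2 / (4 * \<sigma> ^ 4) - real DIM('a) / (2 * \<sigma>\<^sup>2)"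
    using r by (simp add: diff_divide_distrib)
  moreover have "bohm_potential m (isotropic_normal_density \<mu> \<sigma>) x = - (1 / (2 * m)) * (laplacian r x / r x)"
    by (simp add: bohm_potential_def r_def)
  ultimately show ?thesis
    by (simp add: right_diff_distrib)
qed

subsection \<open>Gaussian measures under affine maps\<close>

lemma borel_measurable_isotropic_normal_density [measurable]:
  "isotropic_normal_density \<mu> \<sigma> \<in> borel_measurable borel"
  unfolding isotropic_normal_density_def[abs_def] by measurable

text \<open>The density factorises along the basis, so its integral is a product of integrals of
  one-dimensional normal densities, each equal to one.\<close>

lemma prob_space_isotropic_normal_density:
  fixes \<mu> :: "'a::euclidean_space"
  assumes "0 < \<sigma>"
  shows "prob_space (density lborel (isotropic_normal_density \<mu> \<sigma>))"
proof (rule prob_spaceI)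
  have "(\<integral>\<^sup>+x. ennreal (isotropic_normal_density \<mu> \<sigma> x) \<partial>lborel)
      = (\<integral>\<^sup>+x. (\<Prod>b\<in>Basis. ennreal (normal_density (\<mu> \<bullet> b) \<sigma> (x \<bullet> b))) \<partial>lborel)"
    by (simp add: isotropic_normal_density_eq_prod[OF assms] prod_ennreal)
  also have "\<dots> = (\<Prod>b\<in>Basis. \<integral>\<^sup>+y. ennreal (normal_density (\<mu> \<bullet> b) \<sigma> y) \<partial>lborel)"
    by (intro nn_integral_lborel_prod) auto
  also have "\<dots> = 1"
    using prob_space.emeasure_space_1[OF prob_space_normal_density[OF assms]]
    by (simp add: emeasure_density)
  finally show "emeasure (density lborel (isotropic_normal_density \<mu> \<sigma>))
      (space (density lborel (isotropic_normal_density \<mu> \<sigma>))) = 1"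
    by (simp add: emeasure_density)
qed

lemma probability_density_isotropic_normal:
  fixes \<mu> :: "'a::euclidean_space"
  assumes "0 < \<sigma>"
  shows "probability_density (isotropic_normal_density \<mu> \<sigma>)"
proof -
  have "0 \<le> isotropic_normal_density \<mu> \<sigma> x" for x
    using isotropic_normal_density_pos[OF assms] by (rule less_imp_le)
  moreover from this have "has_bochner_integral lborel (isotropic_normal_density \<mu> \<sigma>) 1"
    using prob_space.emeasure_space_1[OF prob_space_isotropic_normal_density[OF assms]]
    by (intro has_bochner_integral_nn_integral) (auto simp: emeasure_density)
  ultimately show ?thesis
    by (simp add: probability_density_def)
qed

text \<open>Change of variables: the map scales Lebesgue measure by \<open>c ^ DIM('a)\<close>, and
  the two densities differ by exactly this Jacobian.\<close>

lemma distr_isotropic_normal_affine: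
  fixes \<mu> \<nu> :: "'a::euclidean_space"
  assumes "0 < \<sigma>" "0 < \<tau>"
  shows "distr (density lborel (isotropic_normal_density \<mu> \<sigma>)) borel
      (\<lambda>x. \<nu> + (\<tau> / \<sigma>) *\<^sub>R (x - \<mu>)) = density lborel (isotropic_normal_density \<nu> \<tau>)"
proof -
  define c where "c = \<tau> / \<sigma>"
  let ?A = "\<lambda>x. \<nu> + c *\<^sub>R (x - \<mu>)"
  have c: "c > 0"
    using assms by (simp add: c_def)
  \<comment> \<open>This is the form, translation plus scaling, in which
    \<open>lborel_affine\<close> expresses Lebesgue measure through its own image.\<close>
  have A: "(\<nu> - c *\<^sub>R \<mu>) + c *\<^sub>R x = ?A x" for x
    by (simp add: algebra_simps)
  \<comment> \<open>The exponents agree because \<open>\<sigma>\<close> and \<open>\<tau>\<close>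
    measure the same relative distance before and after the map; the ratio of the normalisations is
    the Jacobian.\<close>
  have scale: "c ^ DIM('a) * isotropic_normal_density \<nu> \<tau> (?A x) = isotropic_normal_density \<mu> \<sigma> x" for x
  proof -
    have "(2 * pi * \<tau>\<^sup>2) powr (real DIM('a) / 2) = (2 * pi * \<sigma>\<^sup>2) powr (real DIM('a) / 2) * c ^ DIM('a)"
    proof -
      have "2 * pi * \<tau>\<^sup>2 = 2 * pi * \<sigma>\<^sup>2 * c\<^sup>2"
        using assms by (simp add: c_def power_divide)
      moreover have "(c\<^sup>2) powr (real DIM('a) / 2) = c ^ DIM('a)"
      proof -
        have "(c\<^sup>2) powr (real DIM('a) / 2) = (c powr 2) powr (real DIM('a) / 2)"
          using c by simp
        also have "\<dots> = c powr real DIM('a)"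
          by (simp only: powr_powr) simp
        finally show ?thesis
          using c by (simp only: powr_realpow)
      qed
      ultimately show ?thesis
        by (simp add: powr_mult)
    qed
    then show ?thesis
      using assms c by (simp add: isotropic_normal_density_def c_def power_mult_distrib power_divide)
  qed
  have "density lborel (isotropic_normal_density \<nu> \<tau>)
      = density (density (distr lborel borel ?A) (\<lambda>_. \<bar>c\<bar> ^ DIM('a))) (isotropic_normal_density \<nu> \<tau>)"
    using lborel_affine[of c "\<nu> - c *\<^sub>R \<mu>"] c unfolding A by simp
  also have "\<dots> = density (distr lborel borel ?A) (\<lambda>x. c ^ DIM('a) * isotropic_normal_density \<nu> \<tau> x)"
    using c by (subst density_density_eq) (auto simp: ennreal_mult')
  also have "\<dots> = distr (density lborel (\<lambda>x. c ^ DIM('a) * isotropic_normal_density \<nu> \<tau> (?A x))) borel ?A"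
    by (subst density_distr) auto
  finally show ?thesis
    unfolding scale unfolding c_def ..
qed

lemma distributed_isotropic_normal_affine:
  assumes "distributed M lborel X (isotropic_normal_density \<mu> \<sigma>)" "0 < \<sigma>" "0 < \<tau>"
  shows "distributed M lborel (\<lambda>\<omega>. \<nu> + (\<tau> / \<sigma>) *\<^sub>R (X \<omega> - \<mu>)) (isotropic_normal_density \<nu> \<tau>)"
proof -
  let ?A = "\<lambda>x. \<nu> + (\<tau> / \<sigma>) *\<^sub>R (x - \<mu>)"
  have X [measurable]: "X \<in> measurable M borel"
    using assms(1) by (simp add: distributed_def)
  \<comment> \<open>The random variable has its law over \<open>lborel\<close>, while the affine
    image was computed over \<open>borel\<close>; both have the same measurable sets.\<close>
  have "distr M lborel (\<lambda>\<omega>. ?A (X \<omega>)) = distr (distr M lborel X) borel ?A"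
    by (subst distr_distr) (auto simp: comp_def intro!: distr_cong)
  also have "\<dots> = density lborel (isotropic_normal_density \<nu> \<tau>)"
    using assms by (simp add: distributed_def distr_isotropic_normal_affine)
  finally show ?thesis
    using isotropic_normal_density_pos[OF \<open>0 < \<tau>\<close>] by (simp add: distributed_def)
qed

subsection \<open>Solutions of Gaussian form\<close>

text \<open>The derivative is written as an inner product so that the gradient can be read off by
  \<open>gradient_eq\<close>.\<close>

lemma quadratic_phase_has_derivative:
  fixes u c :: "'a::euclidean_space"
  shows "((\<lambda>y. m * \<alpha> / 2 * (norm (y - c))\<^sup>2 + m * (u \<bullet> (y - c)) + g) has_derivative
      (\<lambda>h. (m *\<^sub>R (u + \<alpha> *\<^sub>R (x - c))) \<bullet> h)) (at x)"
proof -
  define N where "N = (\<lambda>y. (norm (y - c))\<^sup>2)"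
  have N: "(N has_derivative (\<lambda>h. 2 * ((x - c) \<bullet> h))) (at x)"
    unfolding N_def by (rule has_derivative_norm_diff_squared)
  have "((\<lambda>y. m * \<alpha> / 2 * N y + m * (u \<bullet> (y - c)) + g) has_derivative
      (\<lambda>h. m * \<alpha> / 2 * (2 * ((x - c) \<bullet> h)) + m * (u \<bullet> h))) (at x)"
    by (auto intro!: derivative_eq_intros N)
  then show ?thesis
    unfolding N_def by (rule has_derivative_eq_rhs) (simp add: fun_eq_iff inner_add_left algebra_simps)
qed

text \<open>The width enters only through its logarithmic derivative \<open>\<alpha>\<close> and the
  Riccati equation, so no explicit formula for \<open>\<sigma>\<close> is needed here. The phase is
  prescribed on \<open>{0..T}\<close> alone, since a derivative taken within this interval has no
  meaning outside it.\<close>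

lemma gaussian_madelung_solution:
  fixes u :: "'a::euclidean_space" and \<mu> :: "real \<Rightarrow> 'a"
  assumes m: "0 < m" and \<sigma>_pos: "\<And>t. 0 < \<sigma> t"
    and \<mu>: "\<And>t. (\<mu> has_vector_derivative u) (at t within {0..T})"
    and \<sigma>: "\<And>t. t \<in> {0..T} \<Longrightarrow> (\<sigma> has_real_derivative \<alpha> t * \<sigma> t) (at t within {0..T})"
    and \<alpha>: "\<And>t. t \<in> {0..T} \<Longrightarrow>
      (\<alpha> has_real_derivative 1 / (4 * m\<^sup>2 * \<sigma> t ^ 4) - (\<alpha> t)\<^sup>2) (at t within {0..T})"
    and \<gamma>: "\<And>t. t \<in> {0..T} \<Longrightarrow>
      (\<gamma> has_real_derivative m / 2 * (norm u)\<^sup>2 - real DIM('a) / (4 * m * (\<sigma> t)\<^sup>2)) (at t within {0..T})"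
    and \<theta>: "\<And>x t. t \<in> {0..T} \<Longrightarrow>
      \<theta> x t = m * \<alpha> t / 2 * (norm (x - \<mu> t))\<^sup>2 + m * (u \<bullet> (x - \<mu> t)) + \<gamma> t"
  shows "positive_classical_solution m T (isotropic_normal_density (\<mu> 0) (\<sigma> 0)) (\<lambda>x. \<theta> x 0)
    (\<lambda>x t. isotropic_normal_density (\<mu> t) (\<sigma> t) x) \<theta>"
proof -
  define \<rho> where "\<rho> = (\<lambda>x t. isotropic_normal_density (\<mu> t) (\<sigma> t) x)"
  let ?z = "\<lambda>x t. x - \<mu> t"
  have cont: "continuous_on (UNIV \<times> {0..T}) (\<lambda>z::'a \<times> real. f (snd z))" if "continuous_on {0..T} f"
    for f :: "real \<Rightarrow> 'b::topological_space"
    by (rule continuous_on_compose2[OF that]) (auto intro!: continuous_intros)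
  have cont_\<sigma>: "continuous_on (UNIV \<times> {0..T}) (\<lambda>z::'a \<times> real. \<sigma> (snd z))"
    by (intro cont DERIV_continuous_on[OF \<sigma>])
  have cont_\<alpha>: "continuous_on (UNIV \<times> {0..T}) (\<lambda>z::'a \<times> real. \<alpha> (snd z))"
    by (intro cont DERIV_continuous_on[OF \<alpha>])
  have cont_\<gamma>: "continuous_on (UNIV \<times> {0..T}) (\<lambda>z::'a \<times> real. \<gamma> (snd z))"
    by (intro cont DERIV_continuous_on[OF \<gamma>])
  have cont_\<mu>: "continuous_on (UNIV \<times> {0..T}) (\<lambda>z::'a \<times> real. \<mu> (snd z))"
    by (intro cont continuous_on_vector_derivative[OF \<mu>])
  have cont_\<rho>: "continuous_on (UNIV \<times> {0..T}) (\<lambda>z::'a \<times> real. \<rho> (fst z) (snd z))"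
    unfolding \<rho>_def by (intro continuous_intros cont_\<mu> cont_\<sigma> \<sigma>_pos)
  have cont_\<theta>: "continuous_on (UNIV \<times> {0..T}) (\<lambda>z::'a \<times> real. \<theta> (fst z) (snd z))"
  proof -
    have "continuous_on (UNIV \<times> {0..T}) (\<lambda>z::'a \<times> real. m * \<alpha> (snd z) / 2 *
        (norm (fst z - \<mu> (snd z)))\<^sup>2 + m * (u \<bullet> (fst z - \<mu> (snd z))) + \<gamma> (snd z))"
      by (intro continuous_intros cont_\<alpha> cont_\<mu> cont_\<gamma>) auto
    then show ?thesis
      by (rule continuous_on_eq) (auto simp: \<theta>)
  qed
  note cont_all = cont_\<sigma> cont_\<alpha> cont_\<gamma> cont_\<mu> cont_\<rho> cont_\<theta>
  have \<sigma>_nz: "\<sigma> t \<noteq> 0" for t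
    using \<sigma>_pos[of t] by simp

  \<comment> \<open>Pointwise derivatives of density and phase\<close>
  have \<rho>_x: "((\<lambda>y. \<rho> y t) has_derivative (\<lambda>h. - \<rho> x t / (\<sigma> t)\<^sup>2 * (?z x t \<bullet> h))) (at x)" for x t
    unfolding \<rho>_def using isotropic_normal_density_has_derivative[OF \<sigma>_pos] .
  have \<theta>_x: "((\<lambda>y. \<theta> y t) has_derivative (\<lambda>h. (m *\<^sub>R (u + \<alpha> t *\<^sub>R ?z x t)) \<bullet> h)) (at x)"
    if "t \<in> {0..T}" for x t
    unfolding \<theta>[OF that] by (rule quadratic_phase_has_derivative)
  define \<rho>' where "\<rho>' = (\<lambda>x t. \<rho> x t *
      (\<alpha> t * ((norm (?z x t))\<^sup>2 / (\<sigma> t)\<^sup>2 - real DIM('a)) + (?z x t \<bullet> u) / (\<sigma> t)\<^sup>2))"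
  have \<rho>_t: "((\<lambda>s. \<rho> x s) has_real_derivative \<rho>' x t) (at t within {0..T})" if "t \<in> {0..T}" for x t
    using isotropic_normal_density_has_time_derivative[OF \<mu> \<sigma>[OF that] \<sigma>_pos, of x] \<sigma>_nz[of t]
    unfolding \<rho>_def \<rho>'_def by simp
  \<comment> \<open>Terms are sorted by their degree in x - \<open>\<mu> t\<close>. The moving
    centre in the linear term yields -m |u|^2, half of which is compensated by
    \<open>\<gamma>\<close>.\<close>
  define \<theta>' where "\<theta>' = (\<lambda>x t. m / 2 * (1 / (4 * m\<^sup>2 * \<sigma> t ^ 4) - (\<alpha> t)\<^sup>2) * (norm (?z x t))\<^sup>2
      - m * \<alpha> t * (?z x t \<bullet> u) - m / 2 * (norm u)\<^sup>2 - real DIM('a) / (4 * m * (\<sigma> t)\<^sup>2))"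
  have \<theta>_t: "((\<lambda>s. \<theta> x s) has_real_derivative \<theta>' x t) (at t within {0..T})" if t: "t \<in> {0..T}" for x t
  proof -
    define N where "N = (\<lambda>s. (norm (\<mu> s - x))\<^sup>2)"
    have N: "(N has_real_derivative 2 * ((\<mu> t - x) \<bullet> u)) (at t within {0..T})"
      using has_derivative_compose[OF \<mu>[of t, unfolded has_vector_derivative_def]
          has_derivative_norm_diff_squared[of x]]
      unfolding N_def has_field_derivative_def
      by (rule has_derivative_eq_rhs) (simp add: fun_eq_iff)
    define L where "L = (\<lambda>s. u \<bullet> (x - \<mu> s))"
    have "(L has_vector_derivative u \<bullet> (0 - u)) (at t within {0..T})"
      unfolding L_def
      by (intro bounded_linear.has_vector_derivative[OF bounded_linear_inner_right]
          has_vector_derivative_diff has_vector_derivative_const \<mu>)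
    then have L: "(L has_real_derivative u \<bullet> (0 - u)) (at t within {0..T})"
      by (simp add: has_real_derivative_iff_has_vector_derivative)
    have "((\<lambda>s. m / 2 * (\<alpha> s * N s) + m * L s + \<gamma> s) has_real_derivative
        m / 2 * ((1 / (4 * m\<^sup>2 * \<sigma> t ^ 4) - (\<alpha> t)\<^sup>2) * N t + 2 * ((\<mu> t - x) \<bullet> u) * \<alpha> t)
        + m * (u \<bullet> (0 - u)) + (m / 2 * (norm u)\<^sup>2 - real DIM('a) / (4 * m * (\<sigma> t)\<^sup>2))) (at t within {0..T})"
      by (intro DERIV_add DERIV_cmult DERIV_mult \<alpha> \<gamma> N L t)
    moreover have "m / 2 * ((1 / (4 * m\<^sup>2 * \<sigma> t ^ 4) - (\<alpha> t)\<^sup>2) * N t + 2 * ((\<mu> t - x) \<bullet> u) * \<alpha> t)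
        + m * (u \<bullet> (0 - u)) + (m / 2 * (norm u)\<^sup>2 - real DIM('a) / (4 * m * (\<sigma> t)\<^sup>2)) = \<theta>' x t"
    proof -
      have "m / 2 * (K * r + 2 * - zu * A) + m * - uu + (m / 2 * uu - D)
          = m / 2 * K * r - m * A * zu - m / 2 * uu - D" for K r zu A uu D
        by (simp add: algebra_simps)
      moreover have "(\<mu> t - x) \<bullet> u = - (?z x t \<bullet> u)"
        by (simp add: inner_diff_left)
      moreover have "u \<bullet> (0 - u) = - (norm u)\<^sup>2"
        by (simp add: power2_norm_eq_inner)
      moreover have "N t = (norm (?z x t))\<^sup>2"
        by (simp add: N_def norm_minus_commute)
      ultimately show ?thesis
        by (simp only: \<theta>'_def)
    qed
    ultimately have "((\<lambda>s. m / 2 * (\<alpha> s * N s) + m * L s + \<gamma> s) has_real_derivative \<theta>' x t) (at t within {0..T})"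
      by (simp only:)
    then show ?thesis
      \<comment> \<open>The radius 1 is arbitrary: the formula for \<open>\<theta>\<close> holds at
        every time in \<open>{0..T}\<close>.\<close>
      by (rule has_field_derivative_transform_within[OF _ zero_less_one t])
         (simp add: \<theta> N_def L_def norm_minus_commute)
  qed

  \<comment> \<open>Regularity in time and space\<close>
  have "C_time 1 0 T \<rho>"
  proof (rule C_time_1_0I[OF _ _ \<rho>_t])
    show "continuous_on UNIV (\<lambda>x. \<rho> x t)" for t
      unfolding \<rho>_def by (intro continuous_intros \<sigma>_pos)
    show "continuous_on (UNIV \<times> {0..T}) (\<lambda>(x, t). \<rho>' x t)"
      unfolding case_prod_unfold \<rho>'_def by (intro continuous_intros cont_all) (auto simp: \<sigma>_nz)
  qed
  moreover have "C_time 1 0 T \<theta>"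
  proof (rule C_time_1_0I[OF _ _ \<theta>_t])
    show "continuous_on UNIV (\<lambda>x. \<theta> x t)" if "t \<in> {0..T}" for t
      by (rule has_derivative_continuous_on[OF has_derivative_at_withinI[OF \<theta>_x[OF that]]])
    show "continuous_on (UNIV \<times> {0..T}) (\<lambda>(x, t). \<theta>' x t)"
      unfolding case_prod_unfold \<theta>'_def
      by (intro continuous_intros cont_all) (use m in \<open>auto simp: \<sigma>_nz\<close>)
  qed
  moreover have "C_time 0 2 T \<rho>"
  proof -
    \<comment> \<open>This is the first partial derivative in direction \<open>b\<close>. Its own
      derivative in direction \<open>c\<close> is again an explicit jointly continuous function, as
      needed for order two.\<close>
    have "C_time 0 1 T (\<lambda>x t. - \<rho> x t / (\<sigma> t)\<^sup>2 * (?z x t \<bullet> b))" for b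
    proof -
      have "((\<lambda>y. - \<rho> y t / (\<sigma> t)\<^sup>2 * (?z y t \<bullet> b)) has_derivative
          (\<lambda>h. - \<rho> x t / (\<sigma> t)\<^sup>2 * (h \<bullet> b) + \<rho> x t / (\<sigma> t)\<^sup>2 * (?z x t \<bullet> h) / (\<sigma> t)\<^sup>2 * (?z x t \<bullet> b))) (at x)" for x t
        by (rule has_derivative_eq_rhs[OF has_derivative_mult])
           (auto intro!: derivative_eq_intros \<rho>_x simp: \<sigma>_nz)
      moreover have "C_time 0 0 T (\<lambda>x t. - \<rho> x t / (\<sigma> t)\<^sup>2 * (c \<bullet> b)
          + \<rho> x t / (\<sigma> t)\<^sup>2 * (?z x t \<bullet> c) / (\<sigma> t)\<^sup>2 * (?z x t \<bullet> b))" for c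
        by (intro C_time_0_0I, unfold case_prod_unfold)
           (intro continuous_intros cont_all; auto simp: \<sigma>_nz)
      ultimately show ?thesis
        unfolding One_nat_def
        by (intro C_time_0_SucI, unfold case_prod_unfold)
           (intro continuous_intros cont_all; auto simp: \<sigma>_nz)
    qed
    moreover have "continuous_on (UNIV \<times> {0..T}) (\<lambda>(x, t). \<rho> x t)"
      using cont_\<rho> by (simp add: case_prod_unfold)
    ultimately have "C_time 0 (Suc 1) T \<rho>"
      by (intro C_time_0_SucI[OF _ \<rho>_x])
    then show ?thesis
      by (simp only: Suc_1)
  qed
  moreover have "C_time 0 2 T \<theta>"
  proof -
    have "C_time 0 1 T (\<lambda>x t. (m *\<^sub>R (u + \<alpha> t *\<^sub>R ?z x t)) \<bullet> b)" for b
    proof -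
      have "((\<lambda>y. (m *\<^sub>R (u + \<alpha> t *\<^sub>R ?z y t)) \<bullet> b) has_derivative
          (\<lambda>h. (m *\<^sub>R \<alpha> t *\<^sub>R h) \<bullet> b)) (at x)" for x t
        by (auto intro!: derivative_eq_intros)
      moreover have "C_time 0 0 T (\<lambda>(x::'a) t. (m *\<^sub>R \<alpha> t *\<^sub>R c) \<bullet> b)" for c :: 'a
        by (intro C_time_0_0I, unfold case_prod_unfold) (intro continuous_intros cont_all)
      ultimately show ?thesis
        unfolding One_nat_def
        by (intro C_time_0_SucI, unfold case_prod_unfold) (intro continuous_intros cont_all; auto)
    qed
    moreover have "continuous_on (UNIV \<times> {0..T}) (\<lambda>(x, t). \<theta> x t)"
      using cont_\<theta> by (simp add: case_prod_unfold)
    ultimately have "C_time 0 (Suc 1) T \<theta>"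
      by (intro C_time_0_SucI[OF _ \<theta>_x])
    then show ?thesis
      by (simp only: Suc_1)
  qed

  \<comment> \<open>The continuity equation and the phase equation\<close>
  moreover have "free_madelung m T (isotropic_normal_density (\<mu> 0) (\<sigma> 0)) (\<lambda>x. \<theta> x 0) \<rho> \<theta>"
    unfolding free_madelung_def
  proof (intro conjI allI ballI)
    fix x t assume "t \<in> {0<..<T}"
    then have t: "t \<in> {0..T}" and at: "at t within {0..T} = at t"
      by (auto simp: at_within_Icc_at)
    have grad: "gradient (\<lambda>y. \<theta> y t) y = m *\<^sub>R (u + \<alpha> t *\<^sub>R ?z y t)" for y
      by (intro gradient_eq \<theta>_x t)
    \<comment> \<open>The factor \<open>m\<close> of the gradient is moved into both coefficients of
      the affine field, to match the flux formula; it later cancels against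
      \<open>1 / m\<close>.\<close>
    have "divergence (\<lambda>y. \<rho> y t *\<^sub>R m *\<^sub>R (u + \<alpha> t *\<^sub>R ?z y t)) x =
        divergence (\<lambda>y. isotropic_normal_density (\<mu> t) (\<sigma> t) y *\<^sub>R (m *\<^sub>R u + (m * \<alpha> t) *\<^sub>R ?z y t)) x"
      by (simp add: \<rho>_def scaleR_add_right)
    moreover have "R * (A * (r / s - D) + zu / s)
        + 1 / m * (R * (D * (m * A) - m * zu / s - m * A * r / s)) = 0" for R A r s D zu
      using m by (simp add: field_simps)
    ultimately show "deriv (\<lambda>s. \<rho> x s) t
        + 1 / m * divergence (\<lambda>y. \<rho> y t *\<^sub>R gradient (\<lambda>z. \<theta> z t) y) x = 0"
      using DERIV_imp_deriv[OF \<rho>_t[OF t, unfolded at], of x]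
      unfolding grad divergence_isotropic_normal_flux[OF \<sigma>_pos]
      by (simp only: \<rho>'_def \<rho>_def inner_scaleR_right)
    have "(norm (m *\<^sub>R (u + \<alpha> t *\<^sub>R ?z x t)))\<^sup>2 =
        m\<^sup>2 * ((norm u)\<^sup>2 + 2 * \<alpha> t * (?z x t \<bullet> u) + (\<alpha> t)\<^sup>2 * (norm (?z x t))\<^sup>2)"
      by (simp add: power_mult_distrib power2_norm_eq_inner inner_add_left inner_add_right
          inner_commute power2_eq_square[of "\<alpha> t"] mult_ac)
    moreover have "m / 2 * (1 / (4 * m\<^sup>2 * s ^ 4) - A\<^sup>2) * r - m * A * zu - m / 2 * uu - D / (4 * m * s\<^sup>2)
        + 1 / (2 * m) * (m\<^sup>2 * (uu + 2 * A * zu + A\<^sup>2 * r))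
        + 1 / (2 * m) * (D / (2 * s\<^sup>2) - r / (4 * s ^ 4)) = 0" if "s \<noteq> 0" for s A r zu uu D
    proof -
      have "m / 2 * (1 / (4 * m\<^sup>2 * s ^ 4) - A\<^sup>2) * r = r / (8 * m * s ^ 4) - m / 2 * A\<^sup>2 * r"
        using m that by (simp add: field_simps power2_eq_square)
      moreover have "1 / (2 * m) * (m\<^sup>2 * (uu + 2 * A * zu + A\<^sup>2 * r)) = m / 2 * uu + m * A * zu + m / 2 * A\<^sup>2 * r"
        using m by (simp add: field_simps power2_eq_square)
      moreover have "1 / (2 * m) * (D / (2 * s\<^sup>2) - r / (4 * s ^ 4)) = D / (4 * m * s\<^sup>2) - r / (8 * m * s ^ 4)"
        by (simp add: right_diff_distrib mult_ac)
      ultimately show ?thesis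
        by linarith
    qed
    ultimately show "deriv (\<lambda>s. \<theta> x s) t + 1 / (2 * m) * (norm (gradient (\<lambda>y. \<theta> y t) x))\<^sup>2
        + bohm_potential m (\<lambda>y. \<rho> y t) x = 0"
      using DERIV_imp_deriv[OF \<theta>_t[OF t, unfolded at], of x] \<sigma>_nz[of t]
      unfolding grad \<rho>_def bohm_potential_isotropic_normal[OF \<sigma>_pos]
      by (simp only: \<theta>'_def not_False_eq_True)
  qed (simp_all add: \<rho>_def)
  ultimately show ?thesis
    using isotropic_normal_density_pos[OF \<sigma>_pos] probability_density_isotropic_normal[OF \<sigma>_pos]
    unfolding positive_classical_solution_def \<rho>_def by blast
qed

section \<open>Existence and uniqueness of the characteristics\<close>

lemma affine_characteristic_flow:
  fixes u :: "'a::euclidean_space" and \<mu> :: "real \<Rightarrow> 'a"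
  assumes \<sigma>_pos: "\<And>t. 0 < \<sigma> t"
    and \<mu>: "\<And>t. (\<mu> has_vector_derivative u) (at t within {0..T})"
    and \<sigma>: "\<And>t. t \<in> {0..T} \<Longrightarrow> (\<sigma> has_real_derivative \<alpha> t * \<sigma> t) (at t within {0..T})"
    and v: "\<And>x t. t \<in> {0..T} \<Longrightarrow> v x t = u + \<alpha> t *\<^sub>R (x - \<mu> t)"
  shows "characteristic_flow T v (\<lambda>t x. \<mu> t + (\<sigma> t / \<sigma> 0) *\<^sub>R (x - \<mu> 0))"
  unfolding characteristic_flow_def
proof (intro conjI allI impI ballI)
  have \<sigma>_nz: "\<sigma> t \<noteq> 0" for t
    using \<sigma>_pos[of t] by simp
  have cont_\<sigma>: "continuous_on {0..T} \<sigma>"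
    by (rule DERIV_continuous_on[OF \<sigma>])
  have cont_\<mu>: "continuous_on {0..T} \<mu>"
    by (rule continuous_on_vector_derivative[OF \<mu>])
  have at: "at t within {0..T} = at t" "t \<in> {0..T}" if "t \<in> {0<..<T}" for t
    using that by (auto simp: at_within_Icc_at)
  show "solves_characteristics T v (\<lambda>t x. \<mu> t + (\<sigma> t / \<sigma> 0) *\<^sub>R (x - \<mu> 0))"
    unfolding solves_characteristics_def
  proof (intro conjI allI ballI)
    fix x
    show "continuous_on {0..T} (\<lambda>t. \<mu> t + (\<sigma> t / \<sigma> 0) *\<^sub>R (x - \<mu> 0))"
      by (intro continuous_intros cont_\<mu> cont_\<sigma>) (simp add: \<sigma>_nz)
    show "\<mu> 0 + (\<sigma> 0 / \<sigma> 0) *\<^sub>R (x - \<mu> 0) = x"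
      by (simp add: \<sigma>_nz)
    fix t assume t: "t \<in> {0<..<T}"
    have "((\<lambda>s. \<mu> s + (\<sigma> s / \<sigma> 0) *\<^sub>R (x - \<mu> 0)) has_vector_derivative
        u + ((\<sigma> t / \<sigma> 0) *\<^sub>R 0 + (\<alpha> t * \<sigma> t / \<sigma> 0) *\<^sub>R (x - \<mu> 0))) (at t)"
      using \<mu>[of t] \<sigma>[of t] unfolding at(1)[OF t]
      by (intro has_vector_derivative_add has_vector_derivative_scaleR DERIV_cdivide
          has_vector_derivative_const) (use at(2)[OF t] in auto)
    then show "((\<lambda>s. \<mu> s + (\<sigma> s / \<sigma> 0) *\<^sub>R (x - \<mu> 0)) has_vector_derivative
        v (\<mu> t + (\<sigma> t / \<sigma> 0) *\<^sub>R (x - \<mu> 0)) t) (at t)"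
      by (simp add: v[OF at(2)[OF t]])
  qed
  fix Y t x assume Y: "solves_characteristics T v Y" and t: "t \<in> {0..T}"
  \<comment> \<open>In the derivative of this rescaled displacement, the relative velocity
    \<open>\<alpha>\<close> (Y - \<open>\<mu>\<close>) cancels the contribution of 1 /
    \<open>\<sigma>\<close>.\<close>
  define Z where "Z = (\<lambda>s. (1 / \<sigma> s) *\<^sub>R (Y s x - \<mu> s))"
  have "Z t = (1 / \<sigma> 0) *\<^sub>R (x - \<mu> 0)"
  \<comment> \<open>The exceptional set consists of the end points: a solution is differentiable
    only inside the interval, and continuity fixes the rest.\<close>
  proof (rule has_derivative_zero_unique_strong_interval[of "{0, T}" 0 T])
    show "continuous_on {0..T} Z"
      unfolding Z_def using Y
      by (intro continuous_intros cont_\<mu> cont_\<sigma>) (auto simp: \<sigma>_nz solves_characteristics_def)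
    show "Z 0 = (1 / \<sigma> 0) *\<^sub>R (x - \<mu> 0)"
      using Y by (simp add: Z_def solves_characteristics_def)
    fix s assume "s \<in> {0..T} - {0, T}"
    then have s: "s \<in> {0<..<T}"
      by auto
    have Y': "((\<lambda>s. Y s x) has_vector_derivative u + \<alpha> s *\<^sub>R (Y s x - \<mu> s)) (at s)"
      using Y s by (simp add: solves_characteristics_def v[OF at(2)[OF s], symmetric])
    have \<sigma>': "((\<lambda>s. 1 / \<sigma> s) has_real_derivative - \<alpha> s / \<sigma> s) (at s)"
      using \<sigma>[OF at(2)[OF s], unfolded at(1)[OF s]] \<sigma>_nz[of s]
      by (auto intro!: derivative_eq_intros simp: field_simps power2_eq_square)
    have "(Z has_vector_derivative (1 / \<sigma> s) *\<^sub>R ((u + \<alpha> s *\<^sub>R (Y s x - \<mu> s)) - u)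
        + (- \<alpha> s / \<sigma> s) *\<^sub>R (Y s x - \<mu> s)) (at s)"
      unfolding Z_def using \<mu>[of s] unfolding at(1)[OF s]
      by (intro has_vector_derivative_scaleR has_vector_derivative_diff \<sigma>' Y')
    then have "(Z has_vector_derivative 0) (at s)"
      by simp
    then show "(Z has_derivative (\<lambda>h. 0)) (at s within {0..T})"
      by (simp add: has_vector_derivative_def has_derivative_at_withinI)
  qed (use t in auto)
  then have "\<sigma> t *\<^sub>R Z t = (\<sigma> t / \<sigma> 0) *\<^sub>R (x - \<mu> 0)"
    by simp
  then show "Y t x = \<mu> t + (\<sigma> t / \<sigma> 0) *\<^sub>R (x - \<mu> 0)"
    by (simp add: Z_def \<sigma>_nz algebra_simps)
qed

section \<open>The explicit width\<close>

lemma sum_squares_affine_pos: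
  fixes a b k t :: real
  assumes "b \<noteq> 0" "k \<noteq> 0"
  shows "0 < (b + a * t)\<^sup>2 + (k * t)\<^sup>2"
  using assms by (cases "t = 0") (auto intro: add_nonneg_pos)

text \<open>With \<open>P\<close> = \<open>\<sigma>\<^sup>2\<close> and \<open>q\<close> half its
  derivative, \<open>\<alpha>\<close> is q / P. The Riccati equation then follows from the quotient
  rule, once (a^2 + k^2) P - q^2 is seen to be constant in time.\<close>

lemma sqrt_quadratic_has_derivative:
  fixes a b k :: real
  defines "\<sigma> \<equiv> \<lambda>t. sqrt ((b + a * t)\<^sup>2 + (k * t)\<^sup>2)"
    and "\<alpha> \<equiv> \<lambda>t. ((b + a * t) * a + k\<^sup>2 * t) / ((b + a * t)\<^sup>2 + (k * t)\<^sup>2)"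
  assumes "b \<noteq> 0" "k \<noteq> 0"
  shows "(\<sigma> has_real_derivative \<alpha> t * \<sigma> t) (at t within S)"
    and "(\<alpha> has_real_derivative (b * k)\<^sup>2 / \<sigma> t ^ 4 - (\<alpha> t)\<^sup>2) (at t within S)"
proof -
  define P where "P = (\<lambda>t. (b + a * t)\<^sup>2 + (k * t)\<^sup>2)"
  define q where "q = (\<lambda>t. (b + a * t) * a + k\<^sup>2 * t)"
  have pos: "0 < P t"
    using sum_squares_affine_pos[OF assms(3,4)] by (simp add: P_def)
  have P: "(P has_real_derivative 2 * q t) (at t within S)"
    unfolding P_def q_def by (auto intro!: derivative_eq_intros simp: algebra_simps power2_eq_square)
  have q: "(q has_real_derivative a\<^sup>2 + k\<^sup>2) (at t within S)"
    unfolding q_def by (auto intro!: derivative_eq_intros simp: power2_eq_square)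
  have \<sigma>: "\<sigma> = (\<lambda>t. sqrt (P t))" and \<alpha>: "\<alpha> = (\<lambda>t. q t / P t)"
    by (simp_all add: \<sigma>_def \<alpha>_def P_def q_def)
  have "((\<lambda>t. sqrt (P t)) has_real_derivative inverse (sqrt (P t)) / 2 * (2 * q t)) (at t within S)"
    by (rule DERIV_chain2[OF DERIV_real_sqrt[OF pos] P])
  moreover have "inverse (sqrt (P t)) / 2 * (2 * q t) = \<alpha> t * \<sigma> t"
    using pos by (simp add: \<sigma> \<alpha> field_simps)
  ultimately show "(\<sigma> has_real_derivative \<alpha> t * \<sigma> t) (at t within S)"
    by (simp add: \<sigma>)
  have "((\<lambda>t. q t / P t) has_real_derivative
      ((a\<^sup>2 + k\<^sup>2) * P t - q t * (2 * q t)) / (P t * P t)) (at t within S)"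
    using pos by (intro DERIV_divide q P) simp
  moreover have "((a\<^sup>2 + k\<^sup>2) * P t - q t * (2 * q t)) / (P t * P t)
      = (b * k)\<^sup>2 / \<sigma> t ^ 4 - (\<alpha> t)\<^sup>2"
  proof -
    \<comment> \<open>Lagrange's identity for the vectors (b + a t, k t) and (a, k):
      \<open>P t\<close> is the squared length of the first, \<open>q t\<close> their inner product,
      and their determinant is the constant b k.\<close>
    have "(a\<^sup>2 + k\<^sup>2) * P t - (q t)\<^sup>2 = (b * k)\<^sup>2"
      by (simp add: P_def q_def algebra_simps power2_eq_square)
    moreover have "\<sigma> t ^ 4 = P t * P t"
      using pos by (simp add: \<sigma> power4_eq_xxxx)
    ultimately show ?thesis
      by (simp add: \<alpha> power_divide power2_eq_square flip: diff_divide_distrib)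
  qed
  ultimately show "(\<alpha> has_real_derivative (b * k)\<^sup>2 / \<sigma> t ^ 4 - (\<alpha> t)\<^sup>2) (at t within S)"
    by (simp add: \<alpha>)
qed

theorem proposition3p1:
  fixes m T \<sigma>0 a0 c0 :: real
    and \<mu>0 u0 :: "'a::euclidean_space"
    and \<rho>0 \<theta>0 :: "'a \<Rightarrow> real"
    and \<mu> :: "real \<Rightarrow> 'a"
    and \<sigma> \<sigma>' \<gamma> :: "real \<Rightarrow> real"
    and \<rho> \<theta> :: "'a \<Rightarrow> real \<Rightarrow> real"
    and v :: "'a \<Rightarrow> real \<Rightarrow> 'a"
    and X :: "real \<Rightarrow> 'a \<Rightarrow> 'a"
  assumes m: "0 < m" and T: "0 < T" and \<sigma>0: "0 < \<sigma>0"
    and \<rho>0: "\<rho>0 = (\<lambda>x. 1 / (2 * pi * \<sigma>0\<^sup>2) powr (real DIM('a) / 2)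
                        * exp (- (norm (x - \<mu>0))\<^sup>2 / (2 * \<sigma>0\<^sup>2)))"
    and \<theta>0: "\<theta>0 = (\<lambda>x. m * a0 / (2 * \<sigma>0) * (norm (x - \<mu>0))\<^sup>2 + m * (u0 \<bullet> (x - \<mu>0)) + c0)"
    and \<mu>: "\<mu> = (\<lambda>t. \<mu>0 + t *\<^sub>R u0)"
    and \<sigma>: "\<sigma> = (\<lambda>t. sqrt ((\<sigma>0 + a0 * t)\<^sup>2 + t\<^sup>2 / (4 * m\<^sup>2 * \<sigma>0\<^sup>2)))"
    and \<sigma>': "\<sigma>' = (\<lambda>t. vector_derivative \<sigma> (at t within {0..T}))"
    and \<gamma>: "\<gamma> = (\<lambda>t. c0 + m / 2 * (norm u0)\<^sup>2 * t
                     - real DIM('a) / (4 * m) * integral {0..t} (\<lambda>\<tau>. 1 / (\<sigma> \<tau>)\<^sup>2))"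
    and \<rho>: "\<rho> = (\<lambda>x t. 1 / (2 * pi * (\<sigma> t)\<^sup>2) powr (real DIM('a) / 2)
                       * exp (- (norm (x - \<mu> t))\<^sup>2 / (2 * (\<sigma> t)\<^sup>2)))"
    and \<theta>: "\<theta> = (\<lambda>x t. m * \<sigma>' t / (2 * \<sigma> t) * (norm (x - \<mu> t))\<^sup>2
                       + m * (u0 \<bullet> (x - \<mu> t)) + \<gamma> t)"
    and v: "v = (\<lambda>x t. (1 / m) *\<^sub>R gradient (\<lambda>y. \<theta> y t) x)"
    and X: "X = (\<lambda>t x. \<mu> t + (\<sigma> t / \<sigma>0) *\<^sub>R (x - \<mu>0))"
  shows "positive_classical_solution m T \<rho>0 \<theta>0 \<rho> \<theta>
    \<and> (\<forall>x. \<forall>t\<in>{0..T}. v x t = u0 + (\<sigma>' t / \<sigma> t) *\<^sub>R (x - \<mu> t))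
    \<and> characteristic_flow T v X
    \<and> (\<forall>t\<in>{0..T}.
         density lborel \<rho>0 \<in> space (prob_algebra borel)
         \<and> density lborel (\<lambda>x. \<rho> x t) \<in> space (prob_algebra borel)
         \<and> X t \<in> borel_measurable borel
         \<and> distr (density lborel \<rho>0) borel (X t) = density lborel (\<lambda>x. \<rho> x t))
    \<and> (\<forall>(\<Omega> :: 'w measure) X0. prob_space \<Omega>
         \<longrightarrow> distributed \<Omega> lborel X0 (isotropic_normal_density \<mu>0 \<sigma>0)
         \<longrightarrow> (\<forall>t\<in>{0..T}.
               distributed \<Omega> lborel (\<lambda>\<omega>. X t (X0 \<omega>)) (isotropic_normal_density (\<mu> t) (\<sigma> t))))"
proof -
  \<comment> \<open>The choice turns the second summand under the root into (k t)^2 and makes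
    \<open>(\<sigma>0 * k)\<^sup>2\<close> the constant 1 / (4 m^2) of the Riccati equation.\<close>
  define k where "k = 1 / (2 * m * \<sigma>0)"
  define \<alpha> where "\<alpha> = (\<lambda>t. ((\<sigma>0 + a0 * t) * a0 + k\<^sup>2 * t) / ((\<sigma>0 + a0 * t)\<^sup>2 + (k * t)\<^sup>2))"
  have k: "k \<noteq> 0" and \<sigma>0_nz: "\<sigma>0 \<noteq> 0" and \<sigma>0k: "(\<sigma>0 * k)\<^sup>2 = 1 / (4 * m\<^sup>2)"
    using m \<sigma>0 by (simp_all add: k_def power_divide power_mult_distrib)
  have \<sigma>_eq: "\<sigma> = (\<lambda>t. sqrt ((\<sigma>0 + a0 * t)\<^sup>2 + (k * t)\<^sup>2))"
    by (simp add: \<sigma> k_def power_divide power_mult_distrib)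
  have \<sigma>_pos: "0 < \<sigma> t" for t
    using sum_squares_affine_pos[OF \<sigma>0_nz k] by (simp add: \<sigma>_eq)
  have \<sigma>_nz: "\<sigma> t \<noteq> 0" for t
    using \<sigma>_pos[of t] by simp
  have \<sigma>_deriv: "(\<sigma> has_real_derivative \<alpha> t * \<sigma> t) (at t within {0..T})" for t
    unfolding \<sigma>_eq \<alpha>_def by (rule sqrt_quadratic_has_derivative[OF \<sigma>0_nz k])
  have \<alpha>_deriv: "(\<alpha> has_real_derivative 1 / (4 * m\<^sup>2 * \<sigma> t ^ 4) - (\<alpha> t)\<^sup>2) (at t within {0..T})" for t
    using sqrt_quadratic_has_derivative(2)[OF \<sigma>0_nz k, of a0 t "{0..T}"]
    unfolding \<sigma>_eq \<alpha>_def \<sigma>0k by simp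
  have \<mu>_deriv: "(\<mu> has_vector_derivative u0) (at t within {0..T})" for t
    unfolding \<mu> by (auto intro!: derivative_eq_intros)
  have \<gamma>_deriv: "(\<gamma> has_real_derivative m / 2 * (norm u0)\<^sup>2 - real DIM('a) / (4 * m * (\<sigma> t)\<^sup>2))
      (at t within {0..T})" if t: "t \<in> {0..T}" for t
  proof -
    have "continuous_on {0..T} (\<lambda>\<tau>. 1 / (\<sigma> \<tau>)\<^sup>2)"
      by (intro continuous_intros DERIV_continuous_on[OF \<sigma>_deriv]) (simp add: \<sigma>_nz)
    from integral_has_real_derivative[OF this t]
    have "(\<gamma> has_real_derivative 0 + m / 2 * (norm u0)\<^sup>2 * 1 - real DIM('a) / (4 * m) * (1 / (\<sigma> t)\<^sup>2))
      (at t within {0..T})"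
      unfolding \<gamma> by (intro DERIV_add DERIV_diff DERIV_cmult DERIV_const DERIV_ident)
    then show ?thesis
      by simp
  qed
  \<comment> \<open>Derivatives within \<open>{0..T}\<close> are unique because the interval is
    nondegenerate, by \<open>0 < T\<close>.\<close>
  have \<sigma>'_eq: "\<sigma>' t = \<alpha> t * \<sigma> t" if "t \<in> {0..T}" for t
    unfolding \<sigma>' using \<sigma>_deriv[of t] that T
    by (intro vector_derivative_within_closed_interval)
       (auto simp: has_real_derivative_iff_has_vector_derivative)
  have \<theta>_eq: "\<theta> x t = m * \<alpha> t / 2 * (norm (x - \<mu> t))\<^sup>2 + m * (u0 \<bullet> (x - \<mu> t)) + \<gamma> t"
    if "t \<in> {0..T}" for x t
    using \<sigma>_nz[of t] by (simp add: \<theta> \<sigma>'_eq[OF that])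
  have init: "\<sigma> 0 = \<sigma>0" "\<mu> 0 = \<mu>0"
    using \<sigma>0 by (simp_all add: \<sigma> \<mu>)
  have \<rho>_eq: "\<rho> = (\<lambda>x t. isotropic_normal_density (\<mu> t) (\<sigma> t) x)"
    and \<rho>0_eq: "\<rho>0 = isotropic_normal_density \<mu>0 \<sigma>0"
    by (simp_all add: fun_eq_iff \<rho> \<rho>0 isotropic_normal_density_def)
  \<comment> \<open>This matches the quadratic coefficients of the phases at time zero; the
    constants match because the integral in \<open>\<gamma>\<close> over \<open>{0..0}\<close>
    vanishes.\<close>
  have "\<alpha> 0 = a0 / \<sigma>0"
    using \<sigma>0 by (simp add: \<alpha>_def power2_eq_square)
  then have \<theta>0_eq: "\<theta>0 = (\<lambda>x. \<theta> x 0)"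
    using T by (simp add: \<theta>_eq \<theta>0 init \<gamma> mult.commute[of \<sigma>0])
  have v_eq: "v x t = u0 + \<alpha> t *\<^sub>R (x - \<mu> t)" if t: "t \<in> {0..T}" for x t
    unfolding v \<theta>_eq[OF t] gradient_eq[OF quadratic_phase_has_derivative] using m by simp
  have "positive_classical_solution m T \<rho>0 \<theta>0 \<rho> \<theta>"
    using gaussian_madelung_solution[OF m \<sigma>_pos \<mu>_deriv \<sigma>_deriv \<alpha>_deriv \<gamma>_deriv \<theta>_eq]
    by (simp add: \<rho>_eq \<rho>0_eq \<theta>0_eq init)
  moreover have "v x t = u0 + (\<sigma>' t / \<sigma> t) *\<^sub>R (x - \<mu> t)" if "t \<in> {0..T}" for x t
    using \<sigma>_nz[of t] by (simp add: v_eq[OF that] \<sigma>'_eq[OF that])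
  moreover have "characteristic_flow T v X"
    using affine_characteristic_flow[OF \<sigma>_pos \<mu>_deriv \<sigma>_deriv v_eq] by (simp add: X init)
  moreover have "density lborel \<rho>0 \<in> space (prob_algebra borel)"
    by (simp add: space_prob_algebra \<rho>0_eq prob_space_isotropic_normal_density \<sigma>0)
  moreover have "density lborel (\<lambda>x. \<rho> x t) \<in> space (prob_algebra borel)" for t
    by (simp add: space_prob_algebra \<rho>_eq prob_space_isotropic_normal_density \<sigma>_pos)
  moreover have "X t \<in> borel_measurable borel" for t
    unfolding X by measurable
  moreover have "distr (density lborel \<rho>0) borel (X t) = density lborel (\<lambda>x. \<rho> x t)" for t
    unfolding X \<rho>0_eq \<rho>_eq by (rule distr_isotropic_normal_affine[OF \<sigma>0 \<sigma>_pos])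
  moreover have "distributed \<Omega> lborel (\<lambda>\<omega>. X t (X0 \<omega>)) (isotropic_normal_density (\<mu> t) (\<sigma> t))"
    if "distributed \<Omega> lborel X0 (isotropic_normal_density \<mu>0 \<sigma>0)"
    for \<Omega> :: "'w measure" and X0 t
    unfolding X by (rule distributed_isotropic_normal_affine[OF that \<sigma>0 \<sigma>_pos])
  ultimately show ?thesis
    by blast
qed

end
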